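(* Fix positive integers $s\geq 2$ and $d$. For a positive integer $h$, set $n=n(h):=\sum_{i=0}^h s^i$ and let $T_h$ be the balanced $s$-ary tree of height $h$ (which has $n$ vertices). Let $r^*=r^*(h):=\sqrt{d}/(2h)$. Then $r^*$ is a sharp threshold for $\mathcal{G}(n,r,d)$ to contain a copy of $T_h$; that is, for every fixed $\epsilon\in(0,1)$, as $h\to\infty$ we have $\mathbb{P}[\mathcal{G}(n,r,d)\text{ contains a copy of } T_h]\to 0$ whenever $r\leq(1-\epsilon)r^*$, and $\mathbb{P}[\mathcal{G}(n,r,d)\text{ contains a copy of } T_h]\to 1$ whenever $r\geq(1+\epsilon)r^*$.
   Context: The random geometric graph $\mathcal{G}(n,r,d)$ has as vertex set $n$ points sampled independently and uniformly at random from $[0,1]^d$, two vertices being adjacent if their Euclidean distance is at most $r$. For a rooted tree, the layer $V_i$ is the set of vertices at graph distance $i$ from the root; the height is the largest $h$ with $V_h$ nonempty; the children of a vertex in $V_j$ are its neighbours in $V_{j+1}$. The balanced $s$-ary tree of height $h$ is the rooted tree of height $h$ in which every vertex in $V_0,\dots,V_{h-1}$ has exactly $s$ children. "Contains a copy of" means contains a subgraph isomorphic to it (here necessarily spanning). *)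

theory Defs
  imports "HOL-Analysis.Analysis" "HOL-Probability.Probability"
begin

text \<open>Balanced s-ary tree of height h: vertices are words over {0..<s} of length at most h
  (the root is the empty word); the children of a word u are the words u @ [i], i < s.\<close>
definition tree_verts :: "nat \<Rightarrow> nat \<Rightarrow> nat list set" where
  "tree_verts s h = {xs. length xs \<le> h \<and> set xs \<subseteq> {..<s}}"

definition tree_edge :: "nat \<Rightarrow> nat \<Rightarrow> nat list \<Rightarrow> nat list \<Rightarrow> bool" where
  "tree_edge s h u v \<longleftrightarrow> u \<in> tree_verts s h \<and> v \<in> tree_verts s h \<and> (\<exists>i<s. v = u @ [i])"

definition nsize :: "nat \<Rightarrow> nat \<Rightarrow> nat" where
  "nsize s h = (\<Sum>i\<le>h. s ^ i)"

definition rgg_adj :: "real \<Rightarrow> (nat \<Rightarrow> 'a::metric_space) \<Rightarrow> nat \<Rightarrow> nat \<Rightarrow> bool" where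
  "rgg_adj r X i j \<longleftrightarrow> i \<noteq> j \<and> dist (X i) (X j) \<le> r"

definition contains_tree :: "nat \<Rightarrow> nat \<Rightarrow> real \<Rightarrow> nat \<Rightarrow> (nat \<Rightarrow> 'a::metric_space) \<Rightarrow> bool" where
  "contains_tree s h r n X \<longleftrightarrow>
     (\<exists>f. inj_on f (tree_verts s h) \<and> f ` tree_verts s h \<subseteq> {..<n} \<and>
          (\<forall>u v. tree_edge s h u v \<longrightarrow> rgg_adj r X (f u) (f v)))"

definition rgg_space :: "nat \<Rightarrow> (nat \<Rightarrow> real ^ 'd::finite) measure" where
  "rgg_space n = PiM {..<n} (\<lambda>_. uniform_measure lborel (cbox 0 One))"

definition tree_prob :: "'d::finite itself \<Rightarrow> nat \<Rightarrow> nat \<Rightarrow> real \<Rightarrow> real" where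
  "tree_prob _ s h r =
     measure (rgg_space (nsize s h) :: (nat \<Rightarrow> real ^ 'd) measure)
       {X \<in> space (rgg_space (nsize s h)). contains_tree s h r (nsize s h) X}"

definition rstar :: "nat \<Rightarrow> nat \<Rightarrow> real" where
  "rstar d h = sqrt (real d) / (2 * real h)"

end

theory Submission
  imports Defs "HOL-Real_Asymp.Real_Asymp"
begin

text \<open>
  Below the threshold some points lie so close to two opposite corners of the cube that they cannot
  both be within distance \<open>h r\<close> of the point that plays the root; since the tree is spanning, this
  excludes a copy.

  Above the threshold, cut the cube into \<open>m\<^sup>d\<close> cells with \<open>m\<close> a large multiple of \<open>h\<close>. With high
  probability every cell contains far more than \<open>s\<close> to the power \<open>h - l\<close> points, where \<open>l\<close> is a
  small fraction of \<open>h\<close>. Keep the first \<open>l\<close> layers of the tree in the central cell; send the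
  subtree of each vertex of layer \<open>l\<close> along a straight route to a target cell, reached \<open>l\<close> layers
  before the leaves, where all its last layers stay. Choosing the targets appropriately fills every
  cell up to an error of a few subtrees, and the error is corrected exactly by moving leaves to
  adjacent cells according to a flow on a spanning tree of the grid.
\<close>

section \<open>Maps with prescribed fibre sizes, and flows on finite trees\<close>

text \<open>Values are served one at a time: any subset of the right size becomes the fibre of the
  new value, and the rest of \<open>A\<close> goes to the induction. It is used both to choose
  targets of subtrees and to distribute leaves.\<close>

lemma ex_fun_prescribed_fibres:
  assumes "finite C" "finite A" "(\<Sum>c\<in>C. a c) = card A"
  shows "\<exists>f. (\<forall>x\<in>A. f x \<in> C) \<and> (\<forall>c\<in>C. card {x\<in>A. f x = c} = a c)"
  using assms
proof (induction C arbitrary: A rule: finite_induct)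
  case empty
  then show ?case by auto
next
  case (insert c C)
  have "a c \<le> card A" using insert.prems insert.hyps by simp
  then obtain U where U: "U \<subseteq> A" "card U = a c"
    by (meson obtain_subset_with_card_n)
  have fU: "finite U" using U insert.prems finite_subset by blast
  have "card (A - U) = sum a C"
    using U fU insert.prems insert.hyps by (simp add: card_Diff_subset)
  then obtain f where f: "\<forall>x\<in>A - U. f x \<in> C" "\<forall>c\<in>C. card {x\<in>A - U. f x = c} = a c"
    using insert.IH[of "A - U"] insert.prems by auto
  let ?g = "\<lambda>x. if x \<in> U then c else f x"
  have "{x\<in>A. ?g x = c} = U" using U f insert.hyps by auto
  moreover have "{x\<in>A. ?g x = e} = {x\<in>A - U. f x = e}" if "e \<in> C" for e
    using that insert.hyps by auto
  ultimately have "\<forall>e\<in>insert c C. card {x\<in>A. ?g x = e} = a e"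
    using U f by auto
  moreover have "\<forall>x\<in>A. ?g x \<in> insert c C" using f by auto
  ultimately show ?case by (intro exI[of _ ?g] conjI)
qed

text \<open>Bijections between corresponding fibres are glued. This later turns an assignment of
  tree vertices to cells into an assignment to the points lying in those cells.\<close>

lemma ex_bij_betw_same_fibres:
  assumes "finite A" "finite B"
    and "\<And>x. x \<in> A \<Longrightarrow> f x \<in> C" "\<And>y. y \<in> B \<Longrightarrow> g y \<in> C"
    and "\<And>c. c \<in> C \<Longrightarrow> card {x\<in>A. f x = c} = card {y\<in>B. g y = c}"
  shows "\<exists>h. bij_betw h A B \<and> (\<forall>x\<in>A. g (h x) = f x)"
proof -
  have "\<forall>c\<in>C. \<exists>h. bij_betw h {x\<in>A. f x = c} {y\<in>B. g y = c}"
    using assms by (intro ballI finite_same_card_bij) auto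
  then obtain h where h: "\<And>c. c \<in> C \<Longrightarrow> bij_betw (h c) {x\<in>A. f x = c} {y\<in>B. g y = c}"
    by metis
  let ?h = "\<lambda>x. h (f x) x"
  have in_B: "?h x \<in> B" "g (?h x) = f x" if "x \<in> A" for x
    using bij_betwE[OF h[of "f x"]] assms(3) that by auto
  have "inj_on ?h A"
  proof (rule inj_onI)
    fix x y assume xy: "x \<in> A" "y \<in> A" "?h x = ?h y"
    then have "f x = f y" using in_B by metis
    then show "x = y"
      using xy bij_betw_imp_inj_on[OF h[of "f x"]] assms(3) by (auto simp: inj_on_def)
  qed
  moreover have "y \<in> ?h ` A" if "y \<in> B" for y
  proof -
    have "y \<in> h (g y) ` {x\<in>A. f x = g y}"
      using bij_betw_imp_surj_on[OF h[of "g y"]] assms(4) that by auto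
    then obtain x where "x \<in> A" "f x = g y" "y = h (g y) x" by auto
    then have "?h x = y" by simp
    then show ?thesis using \<open>x \<in> A\<close> by blast
  qed
  ultimately have "bij_betw ?h A B" using in_B by (auto simp: bij_betw_def)
  then show ?thesis using in_B by blast
qed

lemma card_eq_sum_fibres:
  assumes "finite A" "finite C" "\<And>x. x \<in> A \<Longrightarrow> f x \<in> C"
  shows "card A = (\<Sum>c\<in>C. card {x\<in>A. f x = c})"
proof -
  have "card (\<Union>c\<in>C. {x\<in>A. f x = c}) = (\<Sum>c\<in>C. card {x\<in>A. f x = c})"
    using assms by (intro card_UN_disjoint) auto
  moreover have "(\<Union>c\<in>C. {x\<in>A. f x = c}) = A" using assms by auto
  ultimately show ?thesis by simp
qed

text \<open>\<open>F c\<close> is the flow along the tree edge from \<open>par c\<close> to \<open>c\<close> when every \<open>c\<close> demands \<open>D c\<close>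
  from the root \<open>c0\<close>.\<close>

lemma ex_tree_flow:
  fixes rank :: "'c \<Rightarrow> nat" and D :: "'c \<Rightarrow> nat"
  assumes "finite C"
    and "\<And>c. c \<in> C \<Longrightarrow> par c \<noteq> c0 \<Longrightarrow> par c \<in> C"
    and "\<And>c. c \<in> C \<Longrightarrow> rank (par c) < rank c"
    and "c0 \<notin> C"
  shows "\<exists>F. (\<forall>c\<in>C. F c = D c + (\<Sum>e | e \<in> C \<and> par e = c. F e)) \<and>
    (\<forall>c. (\<Sum>e | e \<in> C \<and> par e = c. F e) \<le> sum D C)"
  using assms
proof (induction "card C" arbitrary: C D)
  case 0
  then show ?case by auto
next
  case (Suc n)
  have "C \<noteq> {}" using Suc.hyps(2) by auto
  \<comment> \<open>An element of maximal rank is the parent of nobody in \<open>C\<close>, so it is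
    a leaf that can be removed.\<close>
  then obtain x where x: "x \<in> C" "\<And>e. e \<in> C \<Longrightarrow> rank e \<le> rank x"
    using Max_in[of "rank ` C"] Max_ge[of "rank ` C"] Suc.prems(1) by (smt (verit) finite_imageI imageE image_is_empty imageI)
  have nopar: "par e \<noteq> x" if "e \<in> C" for e
    using x Suc.prems(3) that leD by metis
  define C' where "C' = C - {x}"
  have C: "C = insert x C'" "x \<notin> C'" "finite C'" using x Suc.prems(1) by (auto simp: C'_def)
  \<comment> \<open>The edge into the leaf \<open>x\<close> carries exactly \<open>D x\<close>, so
    the parent of \<open>x\<close> takes over this demand. If the parent is \<open>c0\<close>, the
    update is invisible on \<open>C'\<close>.\<close>
  define D' where "D' = D(par x := D (par x) + D x)"
  have "\<exists>F. (\<forall>c\<in>C'. F c = D' c + (\<Sum>e | e \<in> C' \<and> par e = c. F e)) \<and>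
    (\<forall>c. (\<Sum>e | e \<in> C' \<and> par e = c. F e) \<le> sum D' C')"
  proof (rule Suc.hyps(1))
    show "n = card C'" using Suc.hyps(2) C by simp
    show "par c \<in> C'" if "c \<in> C'" "par c \<noteq> c0" for c
      using that nopar Suc.prems(2) by (auto simp: C'_def)
    show "rank (par c) < rank c" if "c \<in> C'" for c
      using that Suc.prems(3) by (auto simp: C'_def)
  qed (use C Suc.prems in \<open>auto simp: C'_def\<close>)
  then obtain F' where F': "\<And>c. c \<in> C' \<Longrightarrow> F' c = D' c + (\<Sum>e | e \<in> C' \<and> par e = c. F' e)"
    "\<And>c. (\<Sum>e | e \<in> C' \<and> par e = c. F' e) \<le> sum D' C'" by blast
  define F where "F = F'(x := D x)"
  have F_eq: "(\<Sum>e | e \<in> C' \<and> par e = c. F e) = (\<Sum>e | e \<in> C' \<and> par e = c. F' e)" for c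
    using C by (intro sum.cong) (auto simp: F_def)
  have sumF: "(\<Sum>e | e \<in> C \<and> par e = c. F e) =
      (\<Sum>e | e \<in> C' \<and> par e = c. F' e) + (if par x = c then D x else 0)" for c
  proof -
    have "{e. e \<in> C \<and> par e = c} =
      (if par x = c then insert x {e. e \<in> C' \<and> par e = c} else {e. e \<in> C' \<and> par e = c})"
      using C by auto
    then show ?thesis using C by (auto simp: F_eq) (simp add: F_def)
  qed
  have x_par: "par x \<noteq> x" using nopar x by auto
  have "F c = D c + (\<Sum>e | e \<in> C \<and> par e = c. F e)" if "c \<in> C" for c
  proof (cases "c = x")
    case True
    have "{e. e \<in> C \<and> par e = c} = {}" using True nopar by auto
    then show ?thesis unfolding F_def using True by (metis add.right_neutral fun_upd_same sum.empty)
  next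
    case False
    then have "c \<in> C'" using that C by auto
    then show ?thesis unfolding sumF using F'(1)[of c] False by (simp add: F_def D'_def)
  qed
  moreover have "(\<Sum>e | e \<in> C \<and> par e = c. F e) \<le> sum D C" for c
  proof (cases "par x = c0")
    case True
    have "sum D' C' = sum D C'"
      using True Suc.prems(4) C by (intro sum.cong) (auto simp: D'_def)
    then show ?thesis unfolding sumF using F'(2)[of c] C by simp
  next
    case False
    then have p: "par x \<in> C'" using Suc.prems(2) x x_par by (auto simp: C'_def)
    have eq: "sum D' C' = sum D C"
      using p C by (simp add: D'_def sum.remove[of C' "par x"])
    show ?thesis
    proof (cases "par x = c")
      case True
      \<comment> \<open>The outflow of \<open>c\<close> is controlled through its inflow
        \<open>F' c\<close>: this includes \<open>D' c\<close>, hence the extra \<open>D x\<close>,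
        and is itself a part of the outflow of \<open>par c\<close>.\<close>
      have "D' c + (\<Sum>e | e \<in> C' \<and> par e = c. F' e) = F' c" using F'(1) p True by simp
      moreover have "F' c \<le> (\<Sum>e | e \<in> C' \<and> par e = par c. F' e)"
        using p True C by (intro member_le_sum) auto
      ultimately show ?thesis unfolding sumF eq[symmetric]
        using F'(2)[of "par c"] True by (simp add: D'_def)
    next
      case False
      then show ?thesis unfolding sumF eq[symmetric] using F'(2)[of c] by simp
    qed
  qed
  ultimately show ?case by blast
qed

section \<open>Counting words, and maps of the tree with prescribed fibre sizes\<close>

lemma sum_power_less_le_power:
  fixes s :: nat
  assumes "s \<ge> 2"
  shows "(\<Sum>i<j. s ^ i) \<le> s ^ j"
proof (induction j)
  case (Suc j)
  have "(\<Sum>i<Suc j. s ^ i) \<le> 2 * s ^ j" using Suc by simp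
  also have "\<dots> \<le> s ^ Suc j" using assms by simp
  finally show ?case .
qed simp

lemma nsize_le: "s \<ge> 2 \<Longrightarrow> nsize s h \<le> 2 * s ^ h"
  using sum_power_less_le_power[of s h] by (simp add: nsize_def lessThan_Suc_atMost[symmetric])

lemma finite_tree_verts [simp]: "finite (tree_verts s h)"
  unfolding tree_verts_def using finite_lists_length_le[of "{..<s}" h] by (simp add: conj_commute)

lemma card_tree_verts: "card (tree_verts s h) = nsize s h"
  unfolding tree_verts_def nsize_def using card_lists_length_le[of "{..<s}" h] by (simp add: conj_commute)

text \<open>Cutting a word after \<open>l\<close> letters separates the prefix, which will decide
  the target, from the suffix, which gives the place inside the subtree.\<close>

lemma card_words_split:
  "card {w. set w \<subseteq> A \<and> l \<le> length w \<and> P (take l w) \<and> Q (drop l w)} =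
   card {p. set p \<subseteq> A \<and> length p = l \<and> P p} * card {u. set u \<subseteq> A \<and> Q u}" (is "card ?W = card ?X * card ?Y")
proof -
  have "bij_betw (\<lambda>w. (take l w, drop l w)) ?W (?X \<times> ?Y)"
  proof (intro bij_betw_byWitness[where f' = "\<lambda>(p, u). p @ u"])
    show "(\<lambda>w. (take l w, drop l w)) ` ?W \<subseteq> ?X \<times> ?Y"
      using set_take_subset set_drop_subset by fastforce
  qed auto
  from bij_betw_same_card[OF this] show ?thesis by (simp only: card_cartesian_product)
qed

text \<open>The map sends the words shorter than \<open>l\<close> to \<open>g\<close>, and lets the last letters of a longer word move
  along the route from \<open>g\<close> to a target that depends on the first \<open>l\<close> letters only. Leaves are then
  pushed from \<open>par c\<close> to \<open>c\<close>; this keeps edges adjacent because the parents of leaves are already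
  at their targets.\<close>

lemma ex_tree_map_prescribed_fibres:
  fixes N :: "'c \<Rightarrow> nat" and rank :: "'c \<Rightarrow> nat"
    and par :: "'c \<Rightarrow> 'c" and adj :: "'c \<Rightarrow> 'c \<Rightarrow> bool" and route :: "'c \<Rightarrow> nat \<Rightarrow> 'c"
  assumes s: "s \<ge> 2" and l: "l \<ge> 1" and h: "h = 2 * l + k"
    and C: "finite C" "c0 \<in> C"
    and par: "\<And>c. c \<in> C \<Longrightarrow> c \<noteq> c0 \<Longrightarrow> par c \<in> C"
      "\<And>c. c \<in> C \<Longrightarrow> c \<noteq> c0 \<Longrightarrow> rank (par c) < rank c"
      "\<And>c. c \<in> C \<Longrightarrow> c \<noteq> c0 \<Longrightarrow> adj (par c) c"
    and adj_refl: "\<And>c. c \<in> C \<Longrightarrow> adj c c"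
    and route: "\<And>c j. c \<in> C \<Longrightarrow> route c j \<in> C" "\<And>c. c \<in> C \<Longrightarrow> route c 0 = g"
      "\<And>c j. c \<in> C \<Longrightarrow> k \<le> j \<Longrightarrow> route c j = c"
      "\<And>c j. c \<in> C \<Longrightarrow> adj (route c j) (route c (Suc j))"
    and N: "sum N C = nsize s h" "\<And>c. c \<in> C \<Longrightarrow> (8 * card C + 4) * s ^ (k + l) \<le> N c"
  shows "\<exists>\<phi>. (\<forall>w\<in>tree_verts s h. \<phi> w \<in> C) \<and>
    (\<forall>u v. tree_edge s h u v \<longrightarrow> adj (\<phi> u) (\<phi> v)) \<and>
    (\<forall>c\<in>C. card {w\<in>tree_verts s h. \<phi> w = c} = N c)"
proof -
  \<comment> \<open>For one vertex of layer \<open>l\<close>, \<open>b\<close> counts its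
    descendants in the last \<open>l + 1\<close> layers, where the route has ended, and
    \<open>S\<close> counts its leaves. \<open>P\<close> is layer \<open>l\<close>, and
    \<open>Sh\<close> consists of the vertices whose images are not controlled exactly.\<close>
  define M where "M = card C"
  define S where "S = s ^ (k + l)"
  define U where "U = {u. set u \<subseteq> {..<s} \<and> k \<le> length u \<and> length u \<le> k + l}"
  define b where "b = card U"
  define V where "V = tree_verts s h"
  define P where "P = {p. set p \<subseteq> {..<s} \<and> length p = l}"
  define Sh where "Sh = {w\<in>V. length w < k + l}"
  have words: "card {w. set w \<subseteq> {..<s} \<and> length w = j} = s ^ j" for j
    using card_lists_length_eq[of "{..<s}" j] by simp
  have finU: "finite U"
    by (rule finite_subset[OF _ finite_tree_verts[of s "k + l"]]) (auto simp: U_def tree_verts_def)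
  have finV: "finite V" by (simp add: V_def)
  have finP: "finite P" unfolding P_def using finite_lists_length_eq[of "{..<s}" l] by simp
  have "S \<ge> 1" using s by (simp add: S_def)
  have Sb: "S \<le> b"
  proof -
    have "card {w. set w \<subseteq> {..<s} \<and> length w = k + l} \<le> b"
      unfolding b_def by (rule card_mono[OF finU]) (auto simp: U_def)
    then show ?thesis unfolding words S_def .
  qed
  have bS: "b \<le> 2 * S"
  proof -
    have "b \<le> card (tree_verts s (k + l))"
      unfolding b_def by (rule card_mono[OF finite_tree_verts]) (auto simp: U_def tree_verts_def)
    then show ?thesis using nsize_le[OF s, of "k + l"] unfolding card_tree_verts S_def by simp
  qed
  \<comment> \<open>By the geometric growth, all uncontrolled vertices together weigh no more than
    the settled part of a single subtree.\<close>
  have Sh_le: "card Sh \<le> S"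
  proof -
    have "Sh \<subseteq> tree_verts s (k + l - 1)" by (auto simp: Sh_def V_def tree_verts_def)
    then have "card Sh \<le> nsize s (k + l - 1)"
      unfolding card_tree_verts[symmetric] by (intro card_mono finite_tree_verts)
    also have "\<dots> = (\<Sum>i<k + l. s ^ i)"
      unfolding nsize_def using l by (intro sum.cong) auto
    finally show ?thesis using sum_power_less_le_power[OF s] unfolding S_def by (rule order_trans)
  qed
  have long: "card {w\<in>V. k + l \<le> length w \<and> Q (take l w)} = card {p\<in>P. Q p} * b" for Q
  proof -
    have "{w\<in>V. k + l \<le> length w \<and> Q (take l w)} =
      {w. set w \<subseteq> {..<s} \<and> l \<le> length w \<and> Q (take l w) \<and> k \<le> length (drop l w) \<and> length (drop l w) \<le> k + l}"
      by (auto simp: V_def tree_verts_def h)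
    then show ?thesis
      unfolding b_def U_def P_def using card_words_split[of "{..<s}" l Q "\<lambda>u. k \<le> length u \<and> length u \<le> k + l"] by simp
  qed
  have leaves: "card {w\<in>V. length w = h \<and> Q (take l w)} = card {p\<in>P. Q p} * S" for Q
  proof -
    have "{w\<in>V. length w = h \<and> Q (take l w)} =
      {w. set w \<subseteq> {..<s} \<and> l \<le> length w \<and> Q (take l w) \<and> length (drop l w) = k + l}"
      by (auto simp: V_def tree_verts_def h)
    then show ?thesis
      unfolding S_def P_def using card_words_split[of "{..<s}" l Q "\<lambda>u. length u = k + l"] words by simp
  qed
  have cardP: "card P = s ^ l" unfolding P_def by (rule words)
  have V_eq: "V = {w\<in>V. k + l \<le> length w} \<union> Sh" by (auto simp: Sh_def)
  have "card V = card {w\<in>V. k + l \<le> length w} + card Sh"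
    using finV by (subst V_eq, intro card_Un_disjoint) (auto simp: Sh_def)
  then have n_eq: "nsize s h = s ^ l * b + card Sh"
    using long[of "\<lambda>_. True"] cardP by (simp add: card_tree_verts V_def)

  let ?C = "C - {c0}"
  \<comment> \<open>\<open>a c\<close> is the number of subtrees sent to \<open>c\<close>. The subtraction of 1 makes room for the short words,
    so that only \<open>c0\<close> can receive more than \<open>N c\<close> vertices.\<close>
  define a where "a c = (if c = c0 then s ^ l - (\<Sum>e\<in>?C. N e div b - 1) else N c div b - 1)" for c
  have "b > 0" using Sb \<open>S \<ge> 1\<close> by linarith
  \<comment> \<open>The hypothesis on \<open>N\<close> is stated in multiples of \<open>S\<close>;
    in multiples of \<open>b\<close> half of the factor is lost, because
    \<open>b \<le> 2 * S\<close>.\<close>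
  have Nb: "(4 * M + 2) * b \<le> N c" if "c \<in> C" for c
  proof -
    have "(4 * M + 2) * b \<le> (4 * M + 2) * (2 * S)" using bS by (rule mult_le_mono2)
    also have "\<dots> = (8 * M + 4) * S" by (simp add: algebra_simps)
    finally show ?thesis using N(2)[OF that] by (simp add: M_def S_def)
  qed
  have aN: "a c * b + b \<le> N c" "N c \<le> a c * b + 2 * b" "4 * M \<le> a c" if "c \<in> ?C" for c
  proof -
    have d: "4 * M + 2 \<le> N c div b" using Nb[of c] that \<open>b > 0\<close>
      by (simp add: less_eq_div_iff_mult_less_eq)
    then have ac: "a c + 1 = N c div b" using that by (simp add: a_def)
    have "(N c div b) * b \<le> N c" by simp
    then show "a c * b + b \<le> N c" by (simp flip: ac)
    have "N c < (N c div b + 1) * b" using \<open>b > 0\<close>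
      by (metis Suc_eq_plus1 dividend_less_div_times mult.commute mult_Suc_right add.commute mult_Suc)
    then show "N c \<le> a c * b + 2 * b" by (simp flip: ac add: algebra_simps)
    show "4 * M \<le> a c" using d ac by linarith
  qed
  have sum_a: "(\<Sum>e\<in>?C. N e div b - 1) = sum a ?C" by (intro sum.cong) (auto simp: a_def)
  \<comment> \<open>This shows that the subtraction defining \<open>a c0\<close> is not truncated,
    and that \<open>c0\<close> also receives at least \<open>4 * M\<close> subtrees.\<close>
  have a_total: "sum a ?C + 4 * M \<le> s ^ l"
  proof -
    have "sum a ?C * b \<le> sum N ?C"
      unfolding sum_distrib_right by (intro sum_mono) (use aN(1) in fastforce)
    moreover have "sum N C = N c0 + sum N ?C" using C by (simp add: sum.remove)
    ultimately have "sum a ?C * b + (4 * M + 2) * b \<le> s ^ l * b + b"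
      using Nb[OF C(2)] n_eq N(1) Sh_le Sb by linarith
    then have "(sum a ?C + 4 * M) * b \<le> s ^ l * b" by (simp add: algebra_simps)
    then show ?thesis using \<open>b > 0\<close> by (meson mult_le_cancel2)
  qed
  have a_c0: "a c0 = s ^ l - sum a ?C" by (simp add: a_def sum_a)
  have a_ge: "4 * M \<le> a c" if "c \<in> C" for c
    using aN(3)[of c] that a_c0 a_total by (cases "c = c0") auto
  have "sum a C = card P" using C a_c0 a_total cardP by (simp add: sum.remove[of C c0])
  then obtain \<tau> where \<tau>: "\<And>p. p \<in> P \<Longrightarrow> \<tau> p \<in> C" "\<And>c. c \<in> C \<Longrightarrow> card {p\<in>P. \<tau> p = c} = a c"
    using ex_fun_prescribed_fibres[OF C(1) finP] by metis
  have "g \<in> C" using route(1,2) C(2) by metis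
  \<comment> \<open>At length \<open>l\<close> the route is at step 0, which is again
    \<open>g\<close>, so the two cases fit together along edges.\<close>
  define \<phi>0 where "\<phi>0 w = (if length w < l then g else route (\<tau> (take l w)) (length w - l))" for w
  have takeP: "take l w \<in> P" if "w \<in> V" "l \<le> length w" for w
    using that set_take_subset[of l w] by (auto simp: P_def V_def tree_verts_def)
  have \<phi>0C: "\<phi>0 w \<in> C" if "w \<in> V" for w
    using takeP[OF that] route(1) \<tau>(1) \<open>g \<in> C\<close> by (auto simp: \<phi>0_def)
  have \<phi>0_long: "\<phi>0 w = \<tau> (take l w)" if "w \<in> V" "k + l \<le> length w" for w
    using takeP[OF that(1)] that route(3) \<tau>(1) by (auto simp: \<phi>0_def)
  have \<phi>0_short: "\<phi>0 w = g" if "w \<in> V" "length w \<le> l" for w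
    using takeP[OF that(1)] that route(2) \<tau>(1) by (auto simp: \<phi>0_def)
  have \<phi>0_edge: "adj (\<phi>0 u) (\<phi>0 (u @ [i]))" if "u \<in> V" "u @ [i] \<in> V" for u i
  proof (cases "l \<le> length u")
    case True
    then show ?thesis using route(4) \<tau>(1) takeP[OF that(1)] by (simp add: \<phi>0_def Suc_diff_le)
  next
    case False
    then show ?thesis using that adj_refl[OF \<open>g \<in> C\<close>] by (simp add: \<phi>0_short)
  qed
  define fib where "fib c = card {w\<in>V. \<phi>0 w = c}" for c
  have long_c: "card {w\<in>V. k + l \<le> length w \<and> \<phi>0 w = c} = a c * b" if "c \<in> C" for c
  proof -
    have "{w\<in>V. k + l \<le> length w \<and> \<phi>0 w = c} = {w\<in>V. k + l \<le> length w \<and> \<tau> (take l w) = c}"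
      using \<phi>0_long by auto
    then show ?thesis using long[of "\<lambda>p. \<tau> p = c"] \<tau>(2)[OF that] by simp
  qed
  have fib_ge: "a c * b \<le> fib c" if "c \<in> C" for c
    unfolding fib_def long_c[OF that, symmetric] using finV by (intro card_mono) auto
  have fib_le: "fib c \<le> a c * b + b" if "c \<in> C" for c
  proof -
    have "fib c \<le> card ({w\<in>V. k + l \<le> length w \<and> \<phi>0 w = c} \<union> Sh)"
      unfolding fib_def using finV by (intro card_mono) (auto simp: Sh_def)
    also have "\<dots> \<le> a c * b + card Sh" using card_Un_le long_c[OF that] by metis
    finally show ?thesis using Sh_le Sb by linarith
  qed

  let ?ch = "\<lambda>c. {e. e \<in> ?C \<and> par e = c}"
  \<comment> \<open>The deficit lies between 0 and \<open>2 * b\<close>: taking one subtree less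
    than the quotient keeps \<open>fib c\<close> below \<open>N c\<close> even if all of
    \<open>Sh\<close> lands in \<open>c\<close>.\<close>
  define D where "D c = N c - fib c" for c
  have D: "N c = fib c + D c" "D c \<le> 4 * S" if "c \<in> ?C" for c
    using aN[OF that] fib_le[of c] fib_ge[of c] that bS unfolding D_def by auto
  have "sum D ?C \<le> card ?C * (4 * S)" using sum_bounded_above[of ?C D "4 * S"] D(2) by simp
  also have "\<dots> \<le> M * (4 * S)" unfolding M_def using C by (intro mult_le_mono1 card_mono) auto
  finally have sumD: "sum D ?C \<le> 4 * M * S" by simp
  have "\<exists>F. (\<forall>c\<in>?C. F c = D c + sum F (?ch c)) \<and> (\<forall>c. sum F (?ch c) \<le> sum D ?C)"
    by (rule ex_tree_flow[where ?c0.0 = c0 and rank = rank]) (use C par in auto)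
  then obtain F where F: "\<And>c. c \<in> ?C \<Longrightarrow> F c = D c + sum F (?ch c)" "\<And>c. sum F (?ch c) \<le> sum D ?C"
    by blast
  define Lf where "Lf c = {w\<in>V. length w = h \<and> \<tau> (take l w) = c}" for c
  have Lf_card: "card (Lf c) = a c * S" if "c \<in> C" for c
    unfolding Lf_def using leaves[of "\<lambda>p. \<tau> p = c"] \<tau>(2)[OF that] by simp
  have Lf_fin: "finite (Lf c)" for c using finV by (simp add: Lf_def)
  have par_ne: "par c \<noteq> c" if "c \<in> ?C" for c using par(2)[of c] that by auto
  \<comment> \<open>This is where the \<open>4 * M\<close> comes from: fewer than or exactly
    \<open>M\<close> deficits of at most \<open>4 * S\<close> each can pass through
    \<open>c\<close>, while its \<open>a c \<ge> 4 * M\<close> subtrees supply \<open>S\<close>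
    leaves each.\<close>
  have out_le: "sum F (?ch c) \<le> a c * S" if "c \<in> C" for c
    using F(2)[of c] sumD mult_le_mono1[OF a_ge[OF that], of S] by linarith
  \<comment> \<open>Of the leaves at \<open>c\<close>, exactly \<open>F e\<close> move on to each
    child \<open>e\<close> and the others stay.\<close>
  have "\<exists>\<mu>. (\<forall>w\<in>Lf c. \<mu> w \<in> insert c (?ch c)) \<and>
      (\<forall>e\<in>insert c (?ch c). card {w\<in>Lf c. \<mu> w = e} = (if e = c then a c * S - sum F (?ch c) else F e))"
    if "c \<in> C" for c
  proof (rule ex_fun_prescribed_fibres)
    have "c \<notin> ?ch c" using par_ne by auto
    then have "(\<Sum>e\<in>?ch c. if e = c then a c * S - sum F (?ch c) else F e) = sum F (?ch c)"
      by (intro sum.cong) auto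
    then show "(\<Sum>e\<in>insert c (?ch c). if e = c then a c * S - sum F (?ch c) else F e) = card (Lf c)"
      using C \<open>c \<notin> ?ch c\<close> out_le[OF that] Lf_card[OF that] by (subst sum.insert) auto
  qed (use C Lf_fin in auto)
  then have "\<forall>c\<in>C. \<exists>\<mu>. (\<forall>w\<in>Lf c. \<mu> w \<in> insert c (?ch c)) \<and>
      (\<forall>e\<in>insert c (?ch c). card {w\<in>Lf c. \<mu> w = e} = (if e = c then a c * S - sum F (?ch c) else F e))"
    by (intro ballI)
  from bchoice[OF this] obtain \<mu> where \<mu>: "\<And>c w. c \<in> C \<Longrightarrow> w \<in> Lf c \<Longrightarrow> \<mu> c w \<in> insert c (?ch c)"
    "\<And>c e. c \<in> C \<Longrightarrow> e \<in> insert c (?ch c) \<Longrightarrow>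
       card {w\<in>Lf c. \<mu> c w = e} = (if e = c then a c * S - sum F (?ch c) else F e)"
    by blast
  define \<phi> where "\<phi> w = (if length w = h then \<mu> (\<tau> (take l w)) w else \<phi>0 w)" for w
  have leaf: "\<tau> (take l w) \<in> C \<and> w \<in> Lf (\<tau> (take l w))" if "w \<in> V" "length w = h" for w
    using \<tau>(1) takeP[OF that(1)] that by (auto simp: Lf_def h)
  have \<phi>C: "\<phi> w \<in> C" if "w \<in> V" for w
    using leaf[OF that] \<mu>(1) \<phi>0C[OF that] by (fastforce simp: \<phi>_def)
  have \<phi>_edge: "adj (\<phi> u) (\<phi> v)" if e: "tree_edge s h u v" for u v
  proof -
    obtain i where v: "v = u @ [i]" "u \<in> V" "v \<in> V" using e unfolding tree_edge_def V_def by blast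
    then have len: "length u < h" by (auto simp: V_def tree_verts_def)
    show ?thesis
    proof (cases "length v = h")
      case True
      let ?c = "\<tau> (take l v)"
      have "\<phi> u = \<phi>0 u" using len by (simp add: \<phi>_def)
      \<comment> \<open>The parent of a leaf has length \<open>h - 1\<close>, which is at least
        \<open>k + l\<close> because \<open>l \<ge> 1\<close>; it shares its first \<open>l\<close>
        letters with the leaf and sits at the common target.\<close>
      also have "\<dots> = ?c" using True v l by (subst \<phi>0_long) (auto simp: h)
      finally have u: "\<phi> u = ?c" .
      have v': "\<phi> v = \<mu> ?c v" using True by (simp add: \<phi>_def)
      show ?thesis
        unfolding u v' using leaf[OF v(3) True] \<mu>(1)[of ?c v] adj_refl[of ?c] par(3)[of "\<mu> ?c v"] by auto
    next
      case False
      then show ?thesis using \<phi>0_edge v len by (simp add: \<phi>_def)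
    qed
  qed
  have fib_split: "fib c = card {w\<in>V. length w \<noteq> h \<and> \<phi>0 w = c} + a c * S" if "c \<in> C" for c
  proof -
    have "{w\<in>V. \<phi>0 w = c} = {w\<in>V. length w \<noteq> h \<and> \<phi>0 w = c} \<union> Lf c"
      using \<phi>0_long by (auto simp: Lf_def h)
    moreover have "card ({w\<in>V. length w \<noteq> h \<and> \<phi>0 w = c} \<union> Lf c) =
        card {w\<in>V. length w \<noteq> h \<and> \<phi>0 w = c} + card (Lf c)"
      using finV Lf_fin by (intro card_Un_disjoint) (auto simp: Lf_def)
    ultimately show ?thesis using Lf_card[OF that] by (simp add: fib_def)
  qed
  have main: "card {w\<in>V. \<phi> w = c} = N c" if c: "c \<in> ?C" for c
  proof -
    have "par c \<in> C" "c \<in> C" using c par by auto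
    let ?A = "{w\<in>V. length w \<noteq> h \<and> \<phi>0 w = c}"
    let ?B = "{w\<in>Lf c. \<mu> c w = c}" and ?B' = "{w\<in>Lf (par c). \<mu> (par c) w = c}"
    have eq: "{w\<in>V. \<phi> w = c} = ?A \<union> (?B \<union> ?B')"
    proof (intro set_eqI iffI)
      fix w assume w: "w \<in> {w\<in>V. \<phi> w = c}"
      show "w \<in> ?A \<union> (?B \<union> ?B')"
      proof (cases "length w = h")
        case True
        let ?e = "\<tau> (take l w)"
        have "\<mu> ?e w = c" using w True by (simp add: \<phi>_def)
        moreover have "w \<in> Lf ?e" "?e \<in> C" using leaf[of w] w True by auto
        ultimately have "c = ?e \<or> par c = ?e" using \<mu>(1)[of ?e w] by auto
        then show ?thesis using \<open>\<mu> ?e w = c\<close> \<open>w \<in> Lf ?e\<close> by auto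
      qed (use w in \<open>auto simp: \<phi>_def\<close>)
    qed (auto simp: \<phi>_def Lf_def)
    have "card (?A \<union> (?B \<union> ?B')) = card ?A + card (?B \<union> ?B')"
      using finV Lf_fin by (intro card_Un_disjoint) (auto simp: Lf_def)
    also have "card (?B \<union> ?B') = card ?B + card ?B'"
      using finV par_ne[OF c] by (intro card_Un_disjoint) (auto simp: Lf_def)
    also have "card ?B = a c * S - sum F (?ch c)" using \<mu>(2)[of c c] c by simp
    also have "card ?B' = F c" using \<mu>(2)[of "par c" c] c \<open>par c \<in> C\<close> par_ne[OF c] by auto
    finally show ?thesis
      using eq F(1)[OF c] D(1)[OF c] fib_split[OF \<open>c \<in> C\<close>] out_le[OF \<open>c \<in> C\<close>] by simp
  qed
  \<comment> \<open>The fibre over \<open>c0\<close> needs no separate count: both sides have the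
    same total, and all other fibres are already correct.\<close>
  have "card V = (\<Sum>c\<in>C. card {w\<in>V. \<phi> w = c})" using finV C(1) \<phi>C by (rule card_eq_sum_fibres)
  then have "sum N C = (\<Sum>c\<in>C. card {w\<in>V. \<phi> w = c})" using N(1) by (simp add: V_def card_tree_verts)
  moreover have "(\<Sum>c\<in>?C. card {w\<in>V. \<phi> w = c}) = sum N ?C" using main by (intro sum.cong) auto
  ultimately have "card {w\<in>V. \<phi> w = c0} = N c0" using C by (simp add: sum.remove[of C c0])
  then have "card {w\<in>V. \<phi> w = c} = N c" if "c \<in> C" for c using main[of c] that by (cases "c = c0") auto
  then show ?thesis using \<phi>C \<phi>_edge unfolding V_def by blast
qed

section \<open>The obstruction below the threshold\<close>

text \<open>A copy uses all the points, so each of the two is joined to the image of the root by at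
  most \<open>h\<close> edges of length at most \<open>r\<close>; the triangle inequality through
  the root gives the contradiction.\<close>

lemma not_contains_tree_if_far_points:
  fixes X :: "nat \<Rightarrow> 'a::metric_space"
  assumes "s \<ge> 2" "h \<ge> 1" and ij: "i < nsize s h" "j < nsize s h" "dist (X i) (X j) > 2 * real h * r"
  shows "\<not> contains_tree s h r (nsize s h) X"
proof
  assume "contains_tree s h r (nsize s h) X"
  then obtain f where f: "inj_on f (tree_verts s h)" "f ` tree_verts s h \<subseteq> {..<nsize s h}"
    and adj: "\<And>u v. tree_edge s h u v \<Longrightarrow> rgg_adj r X (f u) (f v)"
    unfolding contains_tree_def by blast
  have surj: "f ` tree_verts s h = {..<nsize s h}"
    using f by (intro card_subset_eq) (auto simp: card_image card_tree_verts)
  \<comment> \<open>The existence of an edge forces \<open>r \<ge> 0\<close>, without which shorter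
    paths would not obey the bound \<open>h * r\<close>.\<close>
  have "tree_edge s h [] [0]" using assms by (auto simp: tree_edge_def tree_verts_def)
  from adj[OF this] have "r \<ge> 0"
    unfolding rgg_adj_def using zero_le_dist order_trans by blast
  have root: "dist (X (f [])) (X (f w)) \<le> real (length w) * r" if "w \<in> tree_verts s h" for w
    using that
  proof (induction w rule: rev_induct)
    case (snoc a w)
    then have "w \<in> tree_verts s h" "tree_edge s h w (w @ [a])"
      by (auto simp: tree_edge_def tree_verts_def)
    then have "dist (X (f [])) (X (f w)) \<le> real (length w) * r" "dist (X (f w)) (X (f (w @ [a]))) \<le> r"
      using snoc.IH adj unfolding rgg_adj_def by blast+
    then show ?case
      using dist_triangle[of "X (f [])" "X (f (w @ [a]))" "X (f w)"] by (simp add: algebra_simps)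
  qed simp
  have "dist (X (f [])) (X v) \<le> real h * r" if v: "v < nsize s h" for v
  proof -
    have "v \<in> f ` tree_verts s h" using v surj by simp
    then obtain w where w: "w \<in> tree_verts s h" "v = f w" by blast
    have "real (length w) * r \<le> real h * r"
      using w \<open>r \<ge> 0\<close> by (intro mult_right_mono) (auto simp: tree_verts_def)
    then show ?thesis using root[OF w(1)] w(2) by simp
  qed
  from this[OF ij(1)] this[OF ij(2)] have "dist (X i) (X j) \<le> 2 * real h * r"
    using dist_triangle[of "X i" "X j" "X (f [])"] by (simp add: dist_commute)
  then show False using ij(3) by simp
qed

section \<open>The grid of cells and the embedding above the threshold\<close>

definition cells :: "nat \<Rightarrow> ('d::finite \<Rightarrow> nat) set" where
  "cells m = {c. \<forall>i. c i < m}"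

text \<open>The minimum assigns the points of the upper faces of the unit cube to the last cells.\<close>

definition cell_of :: "nat \<Rightarrow> real ^ 'd::finite \<Rightarrow> 'd \<Rightarrow> nat" where
  "cell_of m x = (\<lambda>i. min (nat \<lfloor>real m * x $ i\<rfloor>) (m - 1))"

lemma cells_eq_PiE: "cells m = (UNIV::'d::finite set) \<rightarrow>\<^sub>E {..<m}"
  by (auto simp: cells_def PiE_def)

lemma finite_cells [simp]: "finite (cells m :: ('d::finite \<Rightarrow> nat) set)"
  by (simp add: cells_eq_PiE finite_PiE)

lemma card_cells: "card (cells m :: ('d::finite \<Rightarrow> nat) set) = m ^ CARD('d)"
  by (simp add: cells_eq_PiE card_PiE)

lemma cell_of_in_cells: "m \<ge> 1 \<Longrightarrow> cell_of m x \<in> cells m"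
  by (auto simp: cells_def cell_of_def)

text \<open>The second bound is not strict, since a coordinate equal to 1 belongs to the last
  cell.\<close>

lemma cell_of_bounds:
  fixes x :: "real ^ 'd::finite"
  assumes "m \<ge> 1" "x \<in> cbox 0 One"
  shows "real (cell_of m x i) \<le> real m * x $ i" "real m * x $ i \<le> real (cell_of m x i) + 1"
proof -
  have "axis i 1 \<in> (Basis :: (real ^ 'd) set)" by (simp add: axis_in_Basis_iff)
  from this inner_sum_left_Basis[OF this] have x: "0 \<le> x $ i" "x $ i \<le> 1"
    using assms(2) by (auto simp: mem_box cart_eq_inner_axis)
  then have "0 \<le> real m * x $ i" "real m * x $ i \<le> real m"
    using assms(1) by (auto simp: mult_left_le)
  then show "real (cell_of m x i) \<le> real m * x $ i" "real m * x $ i \<le> real (cell_of m x i) + 1"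
    using assms(1) unfolding cell_of_def by (auto simp: min_def of_nat_diff) linarith+
qed

text \<open>In each coordinate, the positions of the points inside their cells add at most one cell
  width to the offset of the cells.\<close>

lemma dist_le_of_cells:
  fixes x y :: "real ^ 'd::finite"
  assumes "m \<ge> 1" "x \<in> cbox 0 One" "y \<in> cbox 0 One"
    and t: "\<And>i. \<bar>real (cell_of m x i) - real (cell_of m y i)\<bar> \<le> t"
  shows "dist x y \<le> sqrt (real CARD('d)) * ((t + 1) / real m)"
proof -
  have "t \<ge> 0" using t order_trans abs_ge_zero by blast
  have "dist (x $ i) (y $ i) \<le> (t + 1) / real m" for i
  proof -
    have "\<bar>real m * x $ i - real m * y $ i\<bar> \<le> t + 1"
      using cell_of_bounds[OF assms(1,2), of i] cell_of_bounds[OF assms(1,3), of i] t[of i] by linarith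
    then have "real m * \<bar>x $ i - y $ i\<bar> \<le> t + 1"
      by (simp add: abs_mult flip: right_diff_distrib)
    then show ?thesis using assms(1) by (simp add: dist_real_def field_simps)
  qed
  then have "dist x y \<le> L2_set (\<lambda>_. (t + 1) / real m) (UNIV :: 'd set)"
    unfolding dist_vec_def by (intro L2_set_mono) auto
  then show ?thesis using \<open>t \<ge> 0\<close> by (simp add: L2_set_constant)
qed

text \<open>Rounding down shifts both quotients in the same direction by at most 1, so only a single
  1 is lost. It bounds the steps of the rounded routes.\<close>

lemma abs_div_diff_le:
  fixes a b k :: nat
  assumes "k \<ge> 1"
  shows "\<bar>real (a div k) - real (b div k)\<bar> \<le> \<bar>real a - real b\<bar> / real k + 1"
proof -
  have *: "real (c div k) \<le> real c / real k" "real c / real k \<le> real (c div k) + 1" for c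
  proof -
    have "real c = real k * real (c div k) + real (c mod k)"
      by (metis mult_div_mod_eq of_nat_add of_nat_mult)
    moreover have "c mod k < k" using assms by simp
    ultimately show "real (c div k) \<le> real c / real k" "real c / real k \<le> real (c div k) + 1"
      using assms by (auto simp: field_simps)
  qed
  have "\<bar>real a / real k - real b / real k\<bar> = \<bar>real a - real b\<bar> / real k"
    by (simp add: abs_divide flip: diff_divide_distrib)
  then show ?thesis using *[of a] *[of b] by linarith
qed

text \<open>From the central cell every coordinate is within \<open>m / 2\<close>, so a straight
  route of \<open>k\<close> steps moves \<open>m / (2 * k)\<close> cells per step. Rounding adds 1,
  the positions inside the cells add another 1, and division by \<open>m\<close> yields the bound on
  \<open>r\<close>.\<close>

lemma contains_tree_if_cells_full:
  fixes X :: "nat \<Rightarrow> real ^ 'd::finite"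
  assumes s: "s \<ge> 2" and l: "l \<ge> 1" and k: "k \<ge> 1" and h: "h = 2 * l + k" and m: "m \<ge> 1"
    and cube: "\<And>i. i < nsize s h \<Longrightarrow> X i \<in> cbox 0 One"
    and full: "\<And>c. c \<in> cells m \<Longrightarrow>
      (8 * m ^ CARD('d) + 4) * s ^ (k + l) \<le> card {i. i < nsize s h \<and> cell_of m (X i) = c}"
    and r: "sqrt (real CARD('d)) * (1 / (2 * real k) + 2 / real m) \<le> r"
  shows "contains_tree s h r (nsize s h) X"
proof -
  define t where "t = real m / (2 * real k) + 1"
  define g where "g = m div 2"
  define adj where "adj c e \<longleftrightarrow> (\<forall>i. \<bar>real (c i) - real (e i)\<bar> \<le> t)" for c e :: "'d \<Rightarrow> nat"
  define route where "route c j = (\<lambda>i. if k \<le> j then c i else (g * (k - j) + c i * j) div k)"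
    for c :: "'d \<Rightarrow> nat" and j
  \<comment> \<open>Lowering one positive coordinate, no matter which, makes the grid a tree rooted
    at the zero cell, ranked by the coordinate sum.\<close>
  define down where "down c = (SOME i. c i > 0)" for c :: "'d \<Rightarrow> nat"
  define par where "par c = c(down c := c (down c) - 1)" for c
  define N where "N c = card {i. i < nsize s h \<and> cell_of m (X i) = c}" for c
  have t1: "t \<ge> 1" by (simp add: t_def)
  have g: "g < m" "\<And>a. a < m \<Longrightarrow> \<bar>real a - real g\<bar> \<le> real m / 2"
    using m unfolding g_def by (simp, linarith)
  have down: "c (down c) > 0" if "c \<noteq> (\<lambda>_. 0)" for c
  proof -
    have "\<exists>i. c i > 0" using that by auto
    then show ?thesis unfolding down_def by (rule someI_ex)
  qed
  \<comment> \<open>At \<open>j = k\<close> the interpolation formula gives \<open>c\<close> itself,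
    so the last step of the route needs no separate treatment.\<close>
  have num: "route c j = (\<lambda>i. (g * (k - j) + c i * j) div k)" if "j \<le> k" for c j
    using that k by (auto simp: route_def)
  have "\<exists>\<phi>. (\<forall>w\<in>tree_verts s h. \<phi> w \<in> cells m) \<and>
    (\<forall>u v. tree_edge s h u v \<longrightarrow> adj (\<phi> u) (\<phi> v)) \<and>
    (\<forall>c\<in>cells m. card {w\<in>tree_verts s h. \<phi> w = c} = N c)"
  proof (rule ex_tree_map_prescribed_fibres[where ?c0.0 = "\<lambda>_. 0" and par = par and rank = "\<lambda>c. \<Sum>i\<in>UNIV. c i"
        and route = route and g = "\<lambda>_. g", OF s l h])
    fix c :: "'d \<Rightarrow> nat" assume c: "c \<in> cells m"
    show "adj c c" using t1 by (simp add: adj_def)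
    show "route c 0 = (\<lambda>_. g)" using k by (simp add: route_def)
    show "(8 * card (cells m :: ('d \<Rightarrow> nat) set) + 4) * s ^ (k + l) \<le> N c"
      using full[OF c] by (simp add: card_cells N_def)
    {
      assume "c \<noteq> (\<lambda>_. 0)"
      then show "par c \<in> cells m" using c by (auto simp: par_def cells_def less_imp_diff_less)
      show "adj (par c) c" using t1 by (auto simp: adj_def par_def)
      show "(\<Sum>i\<in>UNIV. par c i) < (\<Sum>i\<in>UNIV. c i)"
        using down[OF \<open>c \<noteq> (\<lambda>_. 0)\<close>] by (intro sum_strict_mono_ex1) (auto simp: par_def)
    }
    fix j
    show "k \<le> j \<Longrightarrow> route c j = c" by (simp add: route_def)
    show "route c j \<in> cells m"
    proof (cases "k \<le> j")
      case False
      have "(g * (k - j) + c i * j) div k < m" for i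
      proof -
        have "c i < m" using c by (simp add: cells_def)
        have "g * (k - j) + c i * j \<le> (m - 1) * (k - j) + (m - 1) * j"
          using g(1) \<open>c i < m\<close> by (intro add_mono mult_le_mono1) auto
        also have "\<dots> = (m - 1) * k" using False by (simp flip: add_mult_distrib2)
        also have "\<dots> < m * k" using m k by simp
        finally show ?thesis using k by (simp add: less_mult_imp_div_less)
      qed
      then show ?thesis using False by (simp add: route_def cells_def)
    qed (use c in \<open>simp add: route_def\<close>)
    show "adj (route c j) (route c (Suc j))"
    proof (cases "k \<le> j")
      case True
      then show ?thesis using t1 by (simp add: adj_def route_def)
    next
      case False
      have "\<bar>real (route c j i) - real (route c (Suc j) i)\<bar> \<le> t" for i
      proof -
        let ?a = "g * (k - j) + c i * j" and ?b = "g * (k - Suc j) + c i * Suc j"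
        have "real (k - j) = real k - real j" "real (k - Suc j) = real k - real j - 1"
          using False by auto
        then have "real ?a - real ?b = real g - real (c i)"
          by (simp only: of_nat_add of_nat_mult of_nat_Suc) (simp add: algebra_simps)
        moreover have "\<bar>real g - real (c i)\<bar> \<le> real m / 2"
          using g(2)[of "c i"] c by (simp add: cells_def abs_minus_commute)
        ultimately have "\<bar>real ?a - real ?b\<bar> / real k \<le> real m / 2 / real k"
          by (intro divide_right_mono of_nat_0_le_iff) (simp only:)
        then show ?thesis
          using False num[of j c] num[of "Suc j" c] abs_div_diff_le[OF k, of ?a ?b] by (simp add: t_def)
      qed
      then show ?thesis by (simp add: adj_def)
    qed
  next
    show "(\<lambda>_. 0) \<in> cells m" using m by (simp add: cells_def)
    have "card {..<nsize s h} = (\<Sum>c\<in>cells m. card {i\<in>{..<nsize s h}. cell_of m (X i) = c})"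
      by (rule card_eq_sum_fibres) (auto simp: cell_of_in_cells[OF m])
    then show "sum N (cells m) = nsize s h" by (simp add: N_def)
  qed auto
  then obtain \<phi> where \<phi>: "\<And>w. w \<in> tree_verts s h \<Longrightarrow> \<phi> w \<in> cells m"
    "\<And>u v. tree_edge s h u v \<Longrightarrow> adj (\<phi> u) (\<phi> v)"
    "\<And>c. c \<in> cells m \<Longrightarrow> card {w\<in>tree_verts s h. \<phi> w = c} = N c"
    by blast
  have "\<exists>f. bij_betw f (tree_verts s h) {..<nsize s h} \<and> (\<forall>w\<in>tree_verts s h. cell_of m (X (f w)) = \<phi> w)"
  proof (rule ex_bij_betw_same_fibres[where C = "cells m"])
    fix c :: "'d \<Rightarrow> nat" assume "c \<in> cells m"
    then show "card {w\<in>tree_verts s h. \<phi> w = c} = card {i\<in>{..<nsize s h}. cell_of m (X i) = c}"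
      using \<phi>(3) by (simp add: N_def)
  qed (use \<phi>(1) m cell_of_in_cells in auto)
  then obtain f where f: "bij_betw f (tree_verts s h) {..<nsize s h}"
    "\<And>w. w \<in> tree_verts s h \<Longrightarrow> cell_of m (X (f w)) = \<phi> w" by blast
  have "rgg_adj r X (f u) (f v)" if e: "tree_edge s h u v" for u v
  proof -
    have uv: "u \<in> tree_verts s h" "v \<in> tree_verts s h" "u \<noteq> v" using e by (auto simp: tree_edge_def)
    then have "f u \<noteq> f v" using f(1) by (auto simp: bij_betw_def inj_on_def)
    moreover have "f u < nsize s h" "f v < nsize s h" using f(1) uv by (auto simp: bij_betw_def)
    then have "dist (X (f u)) (X (f v)) \<le> sqrt (real CARD('d)) * ((t + 1) / real m)"
      using \<phi>(2)[OF e] f(2) uv by (intro dist_le_of_cells m cube) (auto simp: adj_def)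
    moreover have "(t + 1) / real m = 1 / (2 * real k) + 2 / real m"
      using m by (simp add: t_def add_divide_distrib)
    ultimately show ?thesis using r by (simp add: rgg_adj_def)
  qed
  then show ?thesis
    unfolding contains_tree_def using f(1) by (intro exI[of _ f]) (auto simp: bij_betw_def)
qed

section \<open>Random points: independence, volumes and measurability\<close>

abbreviation cube_measure :: "(real ^ 'd::finite) measure" where
  "cube_measure \<equiv> uniform_measure lborel (cbox 0 One)"

lemma emeasure_unit_cube [simp]: "emeasure lborel (cbox 0 (One :: 'a::euclidean_space)) = 1"
  by (subst emeasure_lborel_cbox) auto

lemma measure_unit_cube [simp]: "measure lborel (cbox 0 (One :: 'a::euclidean_space)) = 1"
  by (simp add: measure_def)

lemma prob_space_cube_measure: "prob_space (cube_measure :: (real ^ 'd::finite) measure)"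
  by (rule prob_space_uniform_measure) auto

lemma finite_product_prob_space_cube:
  "finite_product_prob_space (\<lambda>_. cube_measure :: (real ^ 'd::finite) measure) {..<n::nat}"
proof -
  interpret prob_space "cube_measure :: (real ^ 'd) measure" by (rule prob_space_cube_measure)
  show ?thesis by unfold_locales auto
qed

lemma prob_space_rgg_space: "prob_space (rgg_space n :: (nat \<Rightarrow> real ^ 'd::finite) measure)"
  unfolding rgg_space_def by (intro prob_space_PiM prob_space_cube_measure)

lemma measurable_rgg_component [measurable]:
  assumes "i < n"
  shows "(\<lambda>X. X i) \<in> rgg_space n \<rightarrow>\<^sub>M (borel :: (real ^ 'd::finite) measure)"
proof -
  have "(\<lambda>X. X i) \<in> rgg_space n \<rightarrow>\<^sub>M (cube_measure :: (real ^ 'd) measure)"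
    unfolding rgg_space_def using assms by (intro measurable_component_singleton) auto
  then show ?thesis by (simp cong: measurable_cong_sets)
qed

lemma sets_avoid:
  fixes A :: "(real ^ 'd::finite) set"
  assumes "J \<subseteq> {..<n}" "A \<in> sets borel"
  shows "{X \<in> space (rgg_space n). \<forall>i\<in>J. X i \<notin> A} \<in> sets (rgg_space n)"
proof -
  have [measurable]: "(\<lambda>X. X i) \<in> rgg_space n \<rightarrow>\<^sub>M (borel :: (real ^ 'd) measure)" if "i \<in> J" for i
    using assms(1) that by (intro measurable_rgg_component) auto
  have "finite J" using assms(1) finite_subset by blast
  then show ?thesis using assms(2) by measurable
qed

text \<open>The event is a product set, with the complement of \<open>A\<close> in the coordinates
  from \<open>J\<close> and the whole space in the others.\<close>

lemma prob_avoid: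
  fixes A :: "(real ^ 'd::finite) set"
  assumes J: "J \<subseteq> {..<n}" and A: "A \<in> sets borel"
  shows "measure (rgg_space n) {X \<in> space (rgg_space n). \<forall>i\<in>J. X i \<notin> A} =
    (1 - measure cube_measure A) ^ card J"
proof -
  interpret U: prob_space "cube_measure :: (real ^ 'd) measure" by (rule prob_space_cube_measure)
  interpret P: finite_product_prob_space "\<lambda>_. cube_measure :: (real ^ 'd) measure" "{..<n}"
    by (rule finite_product_prob_space_cube)
  let ?B = "\<lambda>i. if i \<in> J then - A else UNIV"
  have "{X \<in> space (rgg_space n). \<forall>i\<in>J. X i \<notin> A} = (\<Pi>\<^sub>E i\<in>{..<n}. ?B i)"
    using J by (auto simp: rgg_space_def space_PiM PiE_def Pi_def)
  also have "measure (rgg_space n) \<dots> = (\<Prod>i<n. measure cube_measure (?B i))"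
    unfolding rgg_space_def using A by (intro P.prob_times) auto
  also have "\<dots> = (\<Prod>i<n. if i \<in> J then 1 - measure cube_measure A else 1)"
    using U.prob_compl[of A] A U.prob_space by (intro prod.cong) (auto simp: Compl_eq_Diff_UNIV)
  also have "\<dots> = (\<Prod>i\<in>J. 1 - measure cube_measure A)"
    using J by (simp add: prod.If_cases Int_absorb1)
  finally show ?thesis by simp
qed

text \<open>Points are only ever required to exist in a cell, so its interior suffices; this avoids
  boundary cases and has the volume of a box.\<close>

definition open_cell :: "nat \<Rightarrow> ('d::finite \<Rightarrow> nat) \<Rightarrow> (real ^ 'd) set" where
  "open_cell m c = {x. \<forall>i. real (c i) / real m < x $ i \<and> x $ i < (real (c i) + 1) / real m}"

lemma open_cell_eq_box:
  "open_cell m c = box (\<chi> i. real (c i) / real m) (\<chi> i. (real (c i) + 1) / real m)"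
  by (auto simp: open_cell_def mem_box_cart)

lemma open_cell_in_sets [simp]: "open_cell m c \<in> sets borel"
  by (simp add: open_cell_eq_box)

lemma cell_of_open_cell:
  assumes "m \<ge> 1" "c \<in> cells m" "x \<in> open_cell m c"
  shows "cell_of m x = c"
proof
  fix i
  have "real (c i) < real m * x $ i" "real m * x $ i < real (c i) + 1"
    using assms(1,3) by (auto simp: open_cell_def field_simps)
  then have "\<lfloor>real m * x $ i\<rfloor> = int (c i)" by (intro floor_unique) auto
  moreover have "c i < m" using assms(2) by (simp add: cells_def)
  ultimately show "cell_of m x i = c i" by (simp add: cell_of_def)
qed

lemma measure_open_cell:
  fixes c :: "'d::finite \<Rightarrow> nat"
  assumes m: "m \<ge> 1" and c: "c \<in> cells m"
  shows "measure cube_measure (open_cell m c) = 1 / real m ^ CARD('d)"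
proof -
  have sub: "open_cell m c \<subseteq> cbox 0 One"
  proof
    fix x assume x: "x \<in> open_cell m c"
    have "0 \<le> x $ i \<and> x $ i \<le> 1" for i
    proof -
      have "real (c i) / real m < x $ i" "x $ i < (real (c i) + 1) / real m"
        using x by (auto simp: open_cell_def)
      moreover have "0 \<le> real (c i) / real m" by simp
      moreover have "c i < m" using c by (simp add: cells_def)
      then have "real (c i) + 1 \<le> real m" by linarith
      then have "(real (c i) + 1) / real m \<le> 1" using m by simp
      ultimately show ?thesis by linarith
    qed
    then show "x \<in> cbox 0 One"
      by (auto simp: mem_box inner_sum_left_Basis) (auto simp: Basis_vec_def inner_axis)
  qed
  have diff: "(\<chi> i. (real (c i) + 1) / real m) - (\<chi> i. real (c i) / real m) = (\<chi> i::'d. 1 / real m)"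
    by (simp add: vec_eq_iff flip: diff_divide_distrib)
  have "measure lborel (open_cell m c) = (\<Prod>b\<in>Basis. (\<chi> i::'d. 1 / real m) \<bullet> b)"
    unfolding open_cell_eq_box
    by (subst measure_lborel_box)
      (auto simp: Basis_vec_def inner_axis diff intro!: divide_right_mono)
  also have "\<dots> = (\<Prod>b\<in>(Basis :: (real ^ 'd) set). 1 / real m)"
    by (intro prod.cong) (auto simp: Basis_vec_def inner_axis)
  also have "\<dots> = 1 / real m ^ CARD('d)" by (simp add: power_one_over)
  finally show ?thesis using sub by (subst measure_uniform_measure) (auto simp: Int_absorb1)
qed

text \<open>The event is a finite union, over injections of the vertices, of finite intersections of
  adjacency events. Injections are made extensional so that there are finitely many.\<close>

lemma contains_tree_in_sets:
  "{X \<in> space (rgg_space n). contains_tree s h r n X} \<in>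
     sets (rgg_space n :: (nat \<Rightarrow> real ^ 'd::finite) measure)"
proof -
  let ?V = "tree_verts s h" and ?M = "rgg_space n :: (nat \<Rightarrow> real ^ 'd) measure"
  let ?F = "{f \<in> ?V \<rightarrow>\<^sub>E {..<n}. inj_on f ?V}"
  have adj: "{X \<in> space ?M. rgg_adj r X i j} \<in> sets ?M" if "i < n" "j < n" for i j
  proof -
    note [measurable] = measurable_rgg_component[OF that(1)] measurable_rgg_component[OF that(2)]
    show ?thesis unfolding rgg_adj_def by measurable
  qed
  have "{X \<in> space ?M. contains_tree s h r n X} =
    (\<Union>f\<in>?F. {X \<in> space ?M. \<forall>e\<in>{e \<in> ?V \<times> ?V. tree_edge s h (fst e) (snd e)}. rgg_adj r X (f (fst e)) (f (snd e))})"
    (is "?L = ?R")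
  proof (intro set_eqI iffI)
    fix X assume X: "X \<in> ?L"
    then obtain f where f: "inj_on f ?V" "f ` ?V \<subseteq> {..<n}"
      "\<And>u v. tree_edge s h u v \<Longrightarrow> rgg_adj r X (f u) (f v)" by (auto simp: contains_tree_def)
    have "restrict f ?V \<in> ?F" using f by (auto simp: inj_on_def)
    then show "X \<in> ?R" using X f(3) by (intro UN_I[of "restrict f ?V"]) auto
  next
    fix X assume "X \<in> ?R"
    then obtain f where f: "f \<in> ?F" "X \<in> space ?M"
      "\<forall>e\<in>{e \<in> ?V \<times> ?V. tree_edge s h (fst e) (snd e)}. rgg_adj r X (f (fst e)) (f (snd e))" by blast
    have "rgg_adj r X (f u) (f v)" if "tree_edge s h u v" for u v
      using f(3)[rule_format, of "(u, v)"] that by (auto simp: tree_edge_def)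
    then show "X \<in> ?L" using f(1,2) unfolding contains_tree_def by (auto intro!: exI[of _ f])
  qed
  also have "\<dots> \<in> sets ?M"
  proof (intro sets.finite_UN sets.sets_Collect_finite_All adj)
    show "finite ?F" by (rule finite_subset[of _ "?V \<rightarrow>\<^sub>E {..<n}"]) (auto intro!: finite_PiE finite_tree_verts)
    show "finite {e \<in> ?V \<times> ?V. tree_edge s h (fst e) (snd e)}" by simp
  qed auto
  finally show ?thesis .
qed

section \<open>Bounds on the probability for fixed height\<close>

text \<open>If the tree is contained, one of the two cells at opposite corners has no point in its
  interior, since points of both would be too far apart in every coordinate. The factor 2 is the
  union bound.\<close>

lemma tree_prob_upper:
  assumes s: "s \<ge> 2" "h \<ge> 1" and m: "m \<ge> 2"
    and r: "2 * real h * r < sqrt (real CARD('d)) * (1 - 2 / real m)"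
  shows "tree_prob TYPE('d::finite) s h r \<le> 2 * (1 - 1 / real m ^ CARD('d)) ^ nsize s h"
proof -
  let ?n = "nsize s h"
  let ?M = "rgg_space ?n :: (nat \<Rightarrow> real ^ 'd) measure"
  interpret prob_space ?M by (rule prob_space_rgg_space)
  let ?lo = "\<lambda>_::'d. 0 :: nat" and ?hi = "\<lambda>_::'d. m - 1"
  let ?A = "\<lambda>c. {X \<in> space ?M. \<forall>i\<in>{..<?n}. X i \<notin> open_cell m c}"
  have "{X \<in> space ?M. contains_tree s h r ?n X} \<subseteq> ?A ?lo \<union> ?A ?hi"
  proof
    fix X assume X: "X \<in> {X \<in> space ?M. contains_tree s h r ?n X}"
    show "X \<in> ?A ?lo \<union> ?A ?hi"
    proof (rule ccontr)
      assume "X \<notin> ?A ?lo \<union> ?A ?hi"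
      then obtain i j where ij: "i < ?n" "j < ?n" "X i \<in> open_cell m ?lo" "X j \<in> open_cell m ?hi"
        using X by auto
      have "1 - 2 / real m \<le> dist (X i $ e) (X j $ e)" for e
      proof -
        have "X i $ e < 1 / real m" using ij(3) by (simp add: open_cell_def)
        moreover have "(real m - 1) / real m < X j $ e"
          using ij(4) m by (simp add: open_cell_def of_nat_diff)
        moreover have "(real m - 1) / real m = 1 - 1 / real m" using m by (simp add: field_simps)
        ultimately show ?thesis by (simp add: dist_real_def)
      qed
      then have "L2_set (\<lambda>_. 1 - 2 / real m) (UNIV :: 'd set) \<le> dist (X i) (X j)"
        unfolding dist_vec_def using m by (intro L2_set_mono) auto
      then have "2 * real h * r < dist (X i) (X j)" using r m by (simp add: L2_set_constant)
      from not_contains_tree_if_far_points[OF s ij(1,2) this] X show False by simp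
    qed
  qed
  then have "tree_prob TYPE('d) s h r \<le> prob (?A ?lo \<union> ?A ?hi)"
    unfolding tree_prob_def by (intro finite_measure_mono sets.Un sets_avoid) auto
  also have "\<dots> \<le> prob (?A ?lo) + prob (?A ?hi)"
    by (intro measure_Un_le sets_avoid) auto
  also have "\<dots> = 2 * (1 - 1 / real m ^ CARD('d)) ^ ?n"
  proof -
    have "?lo \<in> cells m" "?hi \<in> cells m" "1 \<le> m" using m by (auto simp: cells_def)
    then show ?thesis
      by (simp only: prob_avoid[OF subset_refl] open_cell_in_sets measure_open_cell) simp
  qed
  finally show ?thesis .
qed

text \<open>A union bound over all pairs of a cell and a block: a block of \<open>B\<close>
  independent points misses a cell of volume \<open>p\<close> with probability
  \<open>(1 - p) ^ B \<le> exp (- B * p)\<close>. Using blocks replaces a concentration inequality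
  for the number of points in a cell.\<close>

lemma tree_prob_lower:
  assumes s: "s \<ge> 2" and l: "l \<ge> 1" and k: "k \<ge> 1" and h: "h = 2 * l + k" and m: "m \<ge> 1"
    and r: "sqrt (real CARD('d)) * (1 / (2 * real k) + 2 / real m) \<le> r"
    and K: "K = (8 * m ^ CARD('d) + 4) * s ^ (k + l)" and B: "K * B \<le> nsize s h"
  shows "1 - real (m ^ CARD('d)) * real K * exp (- real B / real (m ^ CARD('d)))
    \<le> tree_prob TYPE('d::finite) s h r"
proof -
  let ?n = "nsize s h" and ?C = "cells m :: ('d \<Rightarrow> nat) set"
  let ?M = "rgg_space ?n :: (nat \<Rightarrow> real ^ 'd) measure"
  interpret prob_space ?M by (rule prob_space_rgg_space)
  \<comment> \<open>Every cell gets \<open>K\<close> points as soon as it contains a point of each of \<open>K\<close> disjoint blocks of \<open>B\<close> indices.\<close>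
  let ?blk = "\<lambda>j. {j * B..<(j + 1) * B}"
  let ?T = "{X \<in> space ?M. contains_tree s h r ?n X}"
  let ?A = "\<lambda>p. {X \<in> space ?M. \<forall>i\<in>?blk (snd p). X i \<notin> open_cell m (fst p)}"
  \<comment> \<open>The sample space allows points outside the cube, so these null events have to be
    excluded explicitly.\<close>
  let ?O = "\<lambda>i. {X \<in> space ?M. \<forall>i\<in>{i}. X i \<notin> cbox 0 One}"
  let ?bad = "(\<Union>p\<in>?C \<times> {..<K}. ?A p) \<union> (\<Union>i\<in>{..<?n}. ?O i)"
  define p where "p = 1 / real (m ^ CARD('d))"
  have "p > 0" "p \<le> 1" using m by (auto simp: p_def)
  have blk: "?blk j \<subseteq> {..<?n}" if "j < K" for j
  proof -
    have "(j + 1) * B \<le> K * B" using that by (intro mult_le_mono1) auto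
    then show ?thesis using B by auto
  qed
  have A_sets: "?A q \<in> sets ?M" if "q \<in> ?C \<times> {..<K}" for q
    using that by (intro sets_avoid blk) auto
  have O_sets: "?O i \<in> sets ?M" if "i \<in> {..<?n}" for i
    using that by (intro sets_avoid) auto
  have T: "X \<in> ?T" if X: "X \<in> space ?M" "X \<notin> ?bad" for X
  proof -
    have cube: "X i \<in> cbox 0 One" if "i < ?n" for i using X that by auto
    have full: "K \<le> card {i. i < ?n \<and> cell_of m (X i) = c}" if c: "c \<in> ?C" for c
    proof -
      have "\<forall>j\<in>{..<K}. \<exists>i. i \<in> ?blk j \<and> X i \<in> open_cell m c" using X c by fastforce
      then obtain f where f: "\<And>j. j < K \<Longrightarrow> f j \<in> ?blk j" "\<And>j. j < K \<Longrightarrow> X (f j) \<in> open_cell m c"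
        by (metis lessThan_iff)
      \<comment> \<open>The block can be read off from an index, so indices chosen in different
        blocks are distinct.\<close>
      have "j = f j div B" if "j < K" for j
        using f(1)[OF that] by (auto intro!: div_nat_eqI[symmetric] simp: algebra_simps)
      then have "inj_on f {..<K}" by (metis inj_onI lessThan_iff)
      then have "K = card (f ` {..<K})" by (simp add: card_image)
      also have "\<dots> \<le> card {i. i < ?n \<and> cell_of m (X i) = c}"
        using f blk cell_of_open_cell[OF m c] by (intro card_mono) fastforce+
      finally show ?thesis .
    qed
    have "contains_tree s h r ?n X"
      by (rule contains_tree_if_cells_full[OF s l k h m cube _ r]) (use full K in auto)
    then show ?thesis using X by simp
  qed
  have bad_sets: "?bad \<in> sets ?M" using A_sets O_sets by (intro sets.Un sets.finite_UN) auto
  have "prob (\<Union>q\<in>?C \<times> {..<K}. ?A q) \<le> (\<Sum>q\<in>?C \<times> {..<K}. prob (?A q))"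
    using A_sets by (intro finite_measure_subadditive_finite) auto
  also have "\<dots> \<le> (\<Sum>q\<in>?C \<times> {..<K}. exp (- real B * p))"
  proof (intro sum_mono)
    fix q assume q: "q \<in> ?C \<times> {..<K}"
    then have "fst q \<in> ?C" "snd q < K" by auto
    note blk[OF this(2)]
    with \<open>fst q \<in> ?C\<close> have "prob (?A q) = (1 - p) ^ B"
      by (simp only: prob_avoid open_cell_in_sets measure_open_cell[OF m]) (simp add: p_def)
    also have "\<dots> \<le> exp (- p) ^ B"
      using \<open>p \<le> 1\<close> exp_ge_add_one_self[of "- p"] by (intro power_mono) auto
    finally show "prob (?A q) \<le> exp (- real B * p)" by (simp add: exp_of_nat_mult[symmetric])
  qed
  also have "\<dots> = real (m ^ CARD('d)) * real K * exp (- real B * p)"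
    by (simp add: card_cells)
  finally have 1: "prob (\<Union>q\<in>?C \<times> {..<K}. ?A q) \<le> real (m ^ CARD('d)) * real K * exp (- real B * p)" .
  have "prob (\<Union>i\<in>{..<?n}. ?O i) \<le> (\<Sum>i<?n. prob (?O i))"
    using O_sets by (intro finite_measure_subadditive_finite) auto
  also have "\<dots> = 0"
    by (intro sum.neutral ballI) (subst prob_avoid, auto)
  finally have 2: "prob (\<Union>i\<in>{..<?n}. ?O i) \<le> 0" .
  have "prob ?bad \<le> prob (\<Union>q\<in>?C \<times> {..<K}. ?A q) + prob (\<Union>i\<in>{..<?n}. ?O i)"
    using A_sets O_sets by (intro measure_Un_le sets.finite_UN) auto
  then have "prob ?bad \<le> real (m ^ CARD('d)) * real K * exp (- real B * p)" using 1 2 by linarith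
  moreover have "prob (space ?M - ?bad) \<le> prob ?T"
    using T by (intro finite_measure_mono contains_tree_in_sets) blast
  moreover have "prob (space ?M - ?bad) = 1 - prob ?bad" using bad_sets by (rule prob_compl)
  moreover have "tree_prob TYPE('d) s h r = prob ?T" by (simp add: tree_prob_def)
  ultimately show ?thesis by (simp add: p_def)
qed

section \<open>Choice of parameters and limits\<close>

text \<open>This is the failure bound for \<open>m = q * h\<close> and blocks of
  \<open>m ^ d * h ^ 2\<close> indices; the square in the exponent beats
  \<open>s ^ h\<close>.\<close>

lemma polynomial_times_exp_tendsto_0:
  fixes q d :: nat and s :: real
  assumes "q > 0" "s > 1" "d > 0"
  shows "(\<lambda>h. 12 * (real q * real h) ^ (2 * d) * s ^ h * exp (- (real h)\<^sup>2)) \<longlonglongrightarrow> 0"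
proof -
  have "ln s > 0" "real q > 0" "real (2 * d) > 0" using assms by auto
  have "(\<lambda>h. 12 * (real q * real h) powr real (2 * d) * exp (ln s * real h) * exp (- (real h)\<^sup>2)) \<longlonglongrightarrow> 0"
    using \<open>ln s > 0\<close> \<open>real q > 0\<close> \<open>real (2 * d) > 0\<close> by real_asymp
  moreover have "\<forall>\<^sub>F h in sequentially. 12 * (real q * real h) powr real (2 * d) * exp (ln s * real h) * exp (- (real h)\<^sup>2)
      = 12 * (real q * real h) ^ (2 * d) * s ^ h * exp (- (real h)\<^sup>2)"
    using eventually_gt_at_top[of 0]
  proof eventually_elim
    case (elim h)
    have "exp (ln s * real h) = s ^ h"
      using assms(2) exp_of_nat2_mult[of "ln s" h] by simp
    moreover have "(real q * real h) powr real (2 * d) = (real q * real h) ^ (2 * d)"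
      using elim assms by (intro powr_realpow) simp
    ultimately show ?case by simp
  qed
  ultimately show ?thesis by (rule Lim_transform_eventually)
qed

text \<open>With \<open>l = h div q\<close>, the factor \<open>s ^ l\<close> saved by requiring only
  a multiple of \<open>s ^ (k + l)\<close> points per cell pays for all polynomial factors, so that
  the \<open>K\<close> blocks fit into the available indices.\<close>

lemma eventually_polynomial_le_power_div:
  fixes q d s :: nat
  assumes "q > 0" "s \<ge> 2" "d > 0"
  shows "\<forall>\<^sub>F h in sequentially. (8 * (q * h) ^ d + 4) * (q * h) ^ d * h\<^sup>2 \<le> s ^ (h div q)"
proof -
  define c where "c = real (2 * d)"
  have "c > 0" "real q > 0" using assms by (auto simp: c_def)
  \<comment> \<open>Replacing \<open>s\<close> by 2 and \<open>h div q\<close> by the smaller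
    \<open>h / q - 1\<close> leaves an explicit real function of \<open>h\<close>.\<close>
  then have "(\<lambda>h. 12 * (real q * real h) powr c * (real h)\<^sup>2 / 2 powr (real h / real q - 1)) \<longlonglongrightarrow> 0"
    by real_asymp
  then have "\<forall>\<^sub>F h in sequentially. 12 * (real q * real h) powr c * (real h)\<^sup>2 / 2 powr (real h / real q - 1) < 1"
    by (rule order_tendstoD) simp
  then have "\<forall>\<^sub>F h in sequentially. 12 * (real q * real h) powr c * (real h)\<^sup>2 \<le> 2 powr (real h / real q - 1)"
    by eventually_elim simp
  then show ?thesis using eventually_gt_at_top[of 0]
  proof eventually_elim
    case (elim h)
    let ?D = "(q * h) ^ d"
    have "?D \<ge> 1" using elim assms by simp
    then have "8 * ?D + 4 \<le> 12 * ?D" by linarith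
    then have "(8 * ?D + 4) * ?D * h\<^sup>2 \<le> 12 * ?D * ?D * h\<^sup>2" by (intro mult_le_mono1)
    then have "real ((8 * ?D + 4) * ?D * h\<^sup>2) \<le> real (12 * ?D * ?D * h\<^sup>2)" by (simp only: of_nat_le_iff)
    also have "\<dots> = 12 * (real q * real h) ^ (2 * d) * (real h)\<^sup>2"
      by (simp add: power_mult power2_eq_square mult_2 power_add)
    also have "(real q * real h) ^ (2 * d) = (real q * real h) powr c"
      unfolding c_def using elim assms by (intro powr_realpow[symmetric]) simp
    also have "12 * (real q * real h) powr c * (real h)\<^sup>2 \<le> 2 powr (real h / real q - 1)" by (rule elim(1))
    also have "\<dots> \<le> 2 powr real (h div q)"
      using floor_divide_of_nat_eq[where ?'a=real, of h q] by (intro powr_mono) linarith+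
    also have "\<dots> = 2 ^ (h div q)" by (simp add: powr_realpow)
    also have "\<dots> \<le> real s ^ (h div q)" using assms by (intro power_mono) auto
    finally show ?case by (metis of_nat_le_iff of_nat_power)
  qed
qed

lemma power_le_nsize: "s ^ h \<le> nsize s h"
  unfolding nsize_def by (rule member_le_sum) auto

lemma tree_prob_le_1: "tree_prob TYPE('d::finite) s h r \<le> 1"
  unfolding tree_prob_def by (rule prob_space.prob_le_1[OF prob_space_rgg_space])

text \<open>The grid is independent of \<open>h\<close>: once \<open>2 / m < \<epsilon>\<close>, the
  corner cells keep a fixed positive volume while the number of points grows, and the crude bound
  \<open>h \<le> nsize s h\<close> already gives the limit.\<close>

lemma tree_prob_tendsto_0:
  assumes s: "s \<ge> 2" and \<epsilon>: "0 < \<epsilon>"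
    and r: "\<forall>\<^sub>F h in sequentially. r h \<le> (1 - \<epsilon>) * rstar CARD('d) h"
  shows "(\<lambda>h. tree_prob TYPE('d::finite) s h (r h)) \<longlonglongrightarrow> 0"
proof -
  obtain m0 :: nat where m0: "2 / \<epsilon> < real m0" using reals_Archimedean2 by blast
  define m where "m = max 2 m0"
  have "m \<ge> 2" "real m0 \<le> real m" by (auto simp: m_def)
  with m0 have m: "m \<ge> 2" "2 / \<epsilon> < real m" by linarith+
  then have m': "2 / real m < \<epsilon>" using \<epsilon> by (simp add: field_simps)
  define x where "x = 1 - 1 / real m ^ CARD('d)"
  have x: "0 \<le> x" "x < 1" using m(1) by (auto simp: x_def)
  have upper: "\<forall>\<^sub>F h in sequentially. tree_prob TYPE('d) s h (r h) \<le> 2 * x ^ h"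
    using r eventually_gt_at_top[of 0]
  proof eventually_elim
    case (elim h)
    have "2 * real h * r h \<le> 2 * real h * ((1 - \<epsilon>) * rstar CARD('d) h)"
      using elim by (intro mult_left_mono) auto
    also have "\<dots> = sqrt (real CARD('d)) * (1 - \<epsilon>)" using elim by (simp add: rstar_def)
    also have "\<dots> < sqrt (real CARD('d)) * (1 - 2 / real m)" using m' by simp
    finally have "tree_prob TYPE('d) s h (r h) \<le> 2 * x ^ nsize s h"
      unfolding x_def using s m elim by (intro tree_prob_upper) auto
    moreover have "h \<le> nsize s h"
      using power_le_nsize[of s h] less_exp[of h] power_mono[OF s, of h] by linarith
    then have "x ^ nsize s h \<le> x ^ h" using x by (intro power_decreasing) auto
    ultimately show ?case by linarith
  qed
  have lim: "(\<lambda>h. 2 * x ^ h) \<longlonglongrightarrow> 0"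
    using tendsto_mult_right_zero[OF LIMSEQ_power_zero[of x]] x by simp
  have "\<forall>\<^sub>F h in sequentially. 0 \<le> tree_prob TYPE('d) s h (r h)"
    by (simp add: tree_prob_def)
  from tendsto_sandwich[OF this upper tendsto_const lim] show ?thesis .
qed

lemma tree_prob_tendsto_1:
  assumes s: "s \<ge> 2" and \<epsilon>: "0 < \<epsilon>"
    and r: "\<forall>\<^sub>F h in sequentially. r h \<ge> (1 + \<epsilon>) * rstar CARD('d) h"
  shows "(\<lambda>h. tree_prob TYPE('d::finite) s h (r h)) \<longlonglongrightarrow> 1"
proof -
  let ?d = "CARD('d)"
  \<comment> \<open>This bounds the ratio of the required radius to \<open>rstar\<close>: the first
    term is the loss from routing in \<open>k \<ge> h * (1 - 2 / q)\<close> steps, the second is the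
    cell error \<open>2 / m\<close> times \<open>2 * h\<close>, with
    \<open>m = q * h\<close>.\<close>
  have "(\<lambda>q. 1 / (1 - 2 / real q) + 4 / real q) \<longlonglongrightarrow> 1" by real_asymp
  then have "\<forall>\<^sub>F q in sequentially. 1 / (1 - 2 / real q) + 4 / real q < 1 + \<epsilon>"
    by (rule order_tendstoD) (use \<epsilon> in simp)
  then have "\<forall>\<^sub>F q in sequentially. 1 / (1 - 2 / real q) + 4 / real q < 1 + \<epsilon> \<and> q \<ge> 3"
    by (intro eventually_conj eventually_ge_at_top)
  then obtain q :: nat where q: "1 / (1 - 2 / real q) + 4 / real q < 1 + \<epsilon>" "q \<ge> 3"
    using eventually_happens' sequentially_bot by blast
  define err where "err h = 12 * (real q * real h) ^ (2 * ?d) * real s ^ h * exp (- (real h)\<^sup>2)" for h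
  have "q > 0" using q by simp
  note poly = eventually_polynomial_le_power_div[OF this s, of ?d]
  have lower: "\<forall>\<^sub>F h in sequentially. 1 - err h \<le> tree_prob TYPE('d) s h (r h)"
    using r eventually_ge_at_top[of q] poly[OF zero_less_card_finite]
  proof eventually_elim
    case (elim h)
    define l where "l = h div q"
    define k where "k = h - 2 * l"
    define m where "m = q * h"
    let ?D = "m ^ ?d"
    \<comment> \<open>Here \<open>q \<ge> 3\<close> ensures that two stretches of \<open>l\<close>
      layers leave a positive \<open>k\<close>, and \<open>h \<ge> q\<close> ensures
      \<open>l \<ge> 1\<close>.\<close>
    have "l * q \<le> h" by (simp add: l_def)
    moreover have "l * 3 \<le> l * q" using q(2) by simp
    moreover have l: "l \<ge> 1" using elim(2) q(2) by (simp add: l_def div_greater_zero_iff Suc_le_eq)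
    ultimately have k: "k \<ge> 1" and h: "h = 2 * l + k" unfolding k_def by linarith+
    have m: "m \<ge> 1" and "h > 0" using elim(2) q(2) by (auto simp: m_def)
    have q': "1 - 2 / real q > 0" using q(2) by (simp add: field_simps)
    have "real l \<le> real h / real q" unfolding l_def by (rule of_nat_div_le_of_nat)
    have "real h * (1 - 2 / real q) = real h - 2 * (real h / real q)"
      by (simp add: right_diff_distrib)
    also have "\<dots> \<le> real h - 2 * real l"
      by (intro diff_left_mono mult_left_mono) (fact, simp)
    also have "\<dots> = real k" using h by simp
    finally have "real h * (1 - 2 / real q) \<le> real k" .
    then have "1 / (2 * real k) + 2 / real m \<le> 1 / (2 * (real h * (1 - 2 / real q))) + 2 / real m"
      using q' \<open>h > 0\<close> k by (intro add_right_mono divide_left_mono mult_left_mono mult_pos_pos) auto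
    also have "\<dots> = (1 / (1 - 2 / real q) + 4 / real q) / (2 * real h)"
      by (simp add: m_def add_divide_distrib mult_ac)
    also have "\<dots> \<le> (1 + \<epsilon>) / (2 * real h)" using q(1) by (intro divide_right_mono) auto
    finally have "sqrt (real ?d) * (1 / (2 * real k) + 2 / real m) \<le> sqrt (real ?d) * ((1 + \<epsilon>) / (2 * real h))"
      by (rule mult_left_mono) simp
    also have "\<dots> = (1 + \<epsilon>) * rstar ?d h" by (simp add: rstar_def)
    finally have r: "sqrt (real ?d) * (1 / (2 * real k) + 2 / real m) \<le> r h" using elim(1) by linarith
    define K where "K = (8 * ?D + 4) * s ^ (k + l)"
    \<comment> \<open>The factor \<open>?D\<close> cancels the cell volume in the exponent, which
      becomes exactly minus the square of \<open>h\<close>.\<close>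
    define B where "B = ?D * h\<^sup>2"
    have "K * B = ((8 * ?D + 4) * ?D * h\<^sup>2) * s ^ (k + l)" by (simp add: K_def B_def)
    also have "\<dots> \<le> s ^ l * s ^ (k + l)" using elim(3) unfolding m_def l_def by (rule mult_le_mono1)
    also have "\<dots> = s ^ h" by (simp add: h power_add power_mult power2_eq_square mult_ac)
    finally have KB: "K * B \<le> nsize s h" using power_le_nsize order_trans by blast
    have "?D \<ge> 1" using m by simp
    have "real B / real ?D = (real h)\<^sup>2" using m by (simp add: B_def)
    then have exp_eq: "exp (- real B / real ?D) = exp (- (real h)\<^sup>2)" by simp
    have "K \<le> (12 * ?D) * s ^ h"
      unfolding K_def using \<open>?D \<ge> 1\<close> s h by (intro mult_le_mono power_increasing) auto
    then have "?D * K \<le> ?D * ((12 * ?D) * s ^ h)" by (rule mult_le_mono2)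
    then have "real ?D * real K \<le> 12 * (real q * real h) ^ (2 * ?d) * real s ^ h"
      unfolding of_nat_le_iff[symmetric, where ?'a = real] mult_2 power_add
      by (simp add: m_def mult_ac)
    then have "real ?D * real K * exp (- real B / real ?D) \<le> err h"
      unfolding exp_eq err_def by (intro mult_right_mono) auto
    then show ?case using tree_prob_lower[OF s l k h m r K_def KB] by linarith
  qed
  have "err \<longlonglongrightarrow> 0"
    unfolding err_def using s q by (intro polynomial_times_exp_tendsto_0) auto
  from tendsto_diff[OF tendsto_const this, of 1] have lim: "(\<lambda>h. 1 - err h) \<longlonglongrightarrow> 1" by simp
  have "\<forall>\<^sub>F h in sequentially. tree_prob TYPE('d) s h (r h) \<le> 1"
    by (simp add: tree_prob_le_1)
  from tendsto_sandwich[OF lower this lim tendsto_const] show ?thesis .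
qed

theorem theorem1p1:
  fixes s :: nat and \<epsilon> :: real
  assumes "s \<ge> 2" and "0 < \<epsilon>" and "\<epsilon> < 1"
  shows "(\<forall>r :: nat \<Rightarrow> real.
            (\<forall>\<^sub>F h in sequentially. r h \<le> (1 - \<epsilon>) * rstar CARD('d) h) \<longrightarrow>
            (\<lambda>h. tree_prob TYPE('d::finite) s h (r h)) \<longlonglongrightarrow> 0)
       \<and> (\<forall>r :: nat \<Rightarrow> real.
            (\<forall>\<^sub>F h in sequentially. r h \<ge> (1 + \<epsilon>) * rstar CARD('d) h) \<longrightarrow>
            (\<lambda>h. tree_prob TYPE('d) s h (r h)) \<longlonglongrightarrow> 1)"
  using assms tree_prob_tendsto_0 tree_prob_tendsto_1 by blast

end
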